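(* Let $E$ be an arbitrary directed graph. The relation $a\prec x^n a$ is not possible for any nonnegative integer $n$ and any $a\in F_E^\Gamma$.
   Context: Setup. $\Gamma=\{x^n\mid n\in\mathbb Z\}$ is the infinite cyclic group generated by $x$. $E$ is an arbitrary directed graph with vertex set $E^0$, edge set $E^1$, source map $\mathbf s$ and range map $\mathbf r$. A vertex $v$ is regular if $\mathbf s^{-1}(v)$ is finite and nonempty, and an infinite emitter if $\mathbf s^{-1}(v)$ is infinite. For every infinite emitter $v$ and every finite nonempty $Z\subseteq \mathbf s^{-1}(v)$ introduce a symbol $q_Z=q_Z^v$, called an improper vertex; elements of $E^0$ are called proper vertices. $F_E^\Gamma$ is the free commutative $\Gamma$-monoid on all proper and improper vertices (these are called the generators): its elements are finite formal sums of monomials $x^m g$ ($m\in\mathbb Z$, $g$ a generator), and $x^n$ acts by $x^n(x^m g)=x^{n+m}g$. The relation $\to_1$ on $F_E^\Gamma-\{0\}$ is given, for all $a\in F_E^\Gamma$ and $m\in\mathbb Z$, by: (A1) $a+x^m v\to_1 a+\sum_{e\in \mathbf s^{-1}(v)}x^{m+1}\mathbf r(e)$ for $v$ regular; (A2) $a+x^m v\to_1 a+x^m q_Z+\sum_{e\in Z}x^{m+1}\mathbf r(e)$ for $v$ an infinite emitter and $Z\subseteq \mathbf s^{-1}(v)$ finite and nonempty; (A3) $a+x^m q_Z\to_1 a+x^m q_W+\sum_{e\in W-Z}x^{m+1}\mathbf r(e)$ for $v$ an infinite emitter and finite nonempty $Z\subsetneq W\subseteq \mathbf s^{-1}(v)$.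 $\sim$ is the congruence on $F_E^\Gamma$ generated by $\to_1$. For $a,b\in F_E^\Gamma$, $a\precsim b$ means that $a+c\sim b$ for some $c\in F_E^\Gamma$; $a\prec b$ means $a\precsim b$ and not $a\sim b$. *)

theory Defs
  imports "Graph_Theory.Digraph" "HOL-Library.Multiset"
begin

text \<open>
  An arbitrary directed graph is a \<^locale>\<open>wf_digraph\<close>: \<^const>\<open>verts\<close>, \<^const>\<open>arcs\<close> may be
  empty or infinite, loops and parallel arcs are allowed, the source map is \<^const>\<open>tail\<close>, the range
  map is \<^const>\<open>head\<close>, and the set of edges with source \<open>v\<close> is \<^term>\<open>out_arcs E v\<close>.
\<close>

definition regular_vertex :: "('v, 'e) pre_digraph \<Rightarrow> 'v \<Rightarrow> bool" where
  "regular_vertex E v \<longleftrightarrow> v \<in> verts E \<and> finite (out_arcs E v) \<and> out_arcs E v \<noteq> {}"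

definition infinite_emitter :: "('v, 'e) pre_digraph \<Rightarrow> 'v \<Rightarrow> bool" where
  "infinite_emitter E v \<longleftrightarrow> v \<in> verts E \<and> infinite (out_arcs E v)"

text \<open>\<open>Improper v Z\<close> stands for the symbol \<open>q\<^sub>Z\<^sup>v\<close>.\<close>

datatype ('v, 'e) generator = Proper 'v | Improper 'v "'e set"

definition generators :: "('v, 'e) pre_digraph \<Rightarrow> ('v, 'e) generator set" where
  "generators E = Proper ` verts E \<union>
     {Improper v Z | v Z. infinite_emitter E v \<and> finite Z \<and> Z \<noteq> {} \<and> Z \<subseteq> out_arcs E v}"

text \<open>
  Elements of the free commutative \<open>\<Gamma>\<close>-monoid are finite multisets of monomials \<open>x\<^sup>m g\<close>; the
  monomial \<open>x\<^sup>m g\<close> is encoded by the pair \<open>(m, g)\<close>, that is, \<open>x\<^sup>m\<close> is encoded by its exponent.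
\<close>

type_synonym ('v, 'e) formal_sum = "(int \<times> ('v, 'e) generator) multiset"

definition free_monoid :: "('v, 'e) pre_digraph \<Rightarrow> ('v, 'e) formal_sum set" where
  "free_monoid E = {a. set_mset a \<subseteq> UNIV \<times> generators E}"

definition monomial :: "int \<Rightarrow> ('v, 'e) generator \<Rightarrow> ('v, 'e) formal_sum" where
  "monomial m g = {#(m, g)#}"

definition act :: "int \<Rightarrow> ('v, 'e) formal_sum \<Rightarrow> ('v, 'e) formal_sum" where
  "act n a = image_mset (\<lambda>(m, g). (n + m, g)) a"

inductive step1 :: "('v, 'e) pre_digraph \<Rightarrow> ('v, 'e) formal_sum \<Rightarrow> ('v, 'e) formal_sum \<Rightarrow> bool"
  for E :: "('v, 'e) pre_digraph" where
  A1: "\<lbrakk>a \<in> free_monoid E; regular_vertex E v\<rbrakk>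
    \<Longrightarrow> step1 E (a + monomial m (Proper v))
               (a + (\<Sum>e\<in>out_arcs E v. monomial (m + 1) (Proper (head E e))))"
| A2: "\<lbrakk>a \<in> free_monoid E; infinite_emitter E v; finite Z; Z \<noteq> {}; Z \<subseteq> out_arcs E v\<rbrakk>
    \<Longrightarrow> step1 E (a + monomial m (Proper v))
               (a + monomial m (Improper v Z)
                  + (\<Sum>e\<in>Z. monomial (m + 1) (Proper (head E e))))"
| A3: "\<lbrakk>a \<in> free_monoid E; infinite_emitter E v; finite W; Z \<noteq> {}; Z \<subset> W; W \<subseteq> out_arcs E v\<rbrakk>
    \<Longrightarrow> step1 E (a + monomial m (Improper v Z))
               (a + monomial m (Improper v W)
                  + (\<Sum>e\<in>W - Z. monomial (m + 1) (Proper (head E e))))"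

text \<open>
  The congruence of \<open>\<Gamma>\<close>-monoids generated by \<^const>\<open>step1\<close>, i.e. the least equivalence relation
  on \<^term>\<open>free_monoid E\<close> that contains \<^const>\<open>step1\<close> and is compatible with addition and with
  the action of \<open>\<Gamma>\<close>.
\<close>

inductive graph_cong :: "('v, 'e) pre_digraph \<Rightarrow> ('v, 'e) formal_sum \<Rightarrow> ('v, 'e) formal_sum \<Rightarrow> bool"
  for E :: "('v, 'e) pre_digraph" where
  base: "step1 E a b \<Longrightarrow> graph_cong E a b"
| refl: "a \<in> free_monoid E \<Longrightarrow> graph_cong E a a"
| sym: "graph_cong E a b \<Longrightarrow> graph_cong E b a"
| trans: "\<lbrakk>graph_cong E a b; graph_cong E b c\<rbrakk> \<Longrightarrow> graph_cong E a c"
| add: "\<lbrakk>graph_cong E a b; graph_cong E c d\<rbrakk> \<Longrightarrow> graph_cong E (a + c) (b + d)"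
| act: "graph_cong E a b \<Longrightarrow> graph_cong E (act n a) (act n b)"

definition precsim :: "('v, 'e) pre_digraph \<Rightarrow> ('v, 'e) formal_sum \<Rightarrow> ('v, 'e) formal_sum \<Rightarrow> bool" where
  "precsim E a b \<longleftrightarrow> (\<exists>c\<in>free_monoid E. graph_cong E (a + c) b)"

definition strict_prec :: "('v, 'e) pre_digraph \<Rightarrow> ('v, 'e) formal_sum \<Rightarrow> ('v, 'e) formal_sum \<Rightarrow> bool" where
  "strict_prec E a b \<longleftrightarrow> precsim E a b \<and> \<not> graph_cong E a b"

end

theory Submission
  imports Defs
begin

text \<open>
  Fix a finite set \<open>S\<close> of edges and a level \<open>N\<close>, and weigh \<open>x\<^sup>m g\<close> by the number of paths that start
  at \<open>g\<close> and either have length \<open>N - m\<close> or stop earlier, at a sink or at an infinite emitter,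
  where only the edges in \<open>S\<close> may be used to leave an infinite emitter and \<open>q\<^sub>Z\<close> behaves like its
  vertex with the edges in \<open>Z\<close> deleted. A given derivation of \<open>a \<sim> b\<close> involves only finitely many
  levels and finitely many sets \<open>Z\<close>, so \<open>a\<close> and \<open>b\<close> have the same weight once \<open>S\<close> and \<open>N\<close> are large.
  Every generator has positive weight, and weights increase with \<open>N\<close>, so the weight of \<open>x\<^sup>n a\<close>
  is at most that of \<open>a\<close>. Hence \<open>a + c \<sim> x\<^sup>n a\<close> forces \<open>c = 0\<close>.
\<close>

primrec path_weight ::
  "('v, 'e) pre_digraph \<Rightarrow> 'e set \<Rightarrow> nat \<Rightarrow> ('v, 'e) generator \<Rightarrow> nat" where
  "path_weight E S 0 g = 1"
| "path_weight E S (Suc k) g = (case g of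
     Proper v \<Rightarrow>
       if out_arcs E v \<noteq> {} \<and> finite (out_arcs E v)
       then \<Sum>e\<in>out_arcs E v. path_weight E S k (Proper (head E e))
       else 1 + (\<Sum>e\<in>out_arcs E v \<inter> S. path_weight E S k (Proper (head E e)))
   | Improper v Z \<Rightarrow> 1 + (\<Sum>e\<in>out_arcs E v \<inter> S - Z. path_weight E S k (Proper (head E e))))"

lemma path_weight_pos: "path_weight E S k g > 0"
proof (induction k arbitrary: g)
  case (Suc k)
  then have "path_weight E S k g \<noteq> 0" for g
    by (metis less_irrefl)
  note [simp] = this
  show ?case by (auto split: generator.split)
qed simp

text \<open>For finite \<open>S\<close>, raising the length bound loses no path: a path of full
  length can be prolonged by an edge or now counts as stopped at its end.\<close>

lemma path_weight_Suc_mono: "path_weight E S k g \<le> path_weight E S (Suc k) g"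
proof (induction k arbitrary: g)
  case 0
  show ?case using path_weight_pos[of E S "Suc 0" g] by simp
next
  case (Suc k)
  show ?case
    using Suc.IH
    by (subst (1 2) path_weight.simps(2))
      (auto split: generator.split intro!: sum_mono simp del: path_weight.simps)
qed

lemma path_weight_mono: "k \<le> l \<Longrightarrow> path_weight E S k g \<le> path_weight E S l g"
  by (rule lift_Suc_mono_le[of "\<lambda>k. path_weight E S k g", OF path_weight_Suc_mono])

text \<open>Since \<open>nat\<close> truncates, a monomial with \<open>m > N\<close> has weight 1.
  This keeps weights positive and monotone in \<open>N\<close>, but invariance under a step needs a
  large \<open>N\<close>.\<close>

definition weight ::
  "('v, 'e) pre_digraph \<Rightarrow> 'e set \<Rightarrow> int \<Rightarrow> ('v, 'e) formal_sum \<Rightarrow> nat" where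
  "weight E S N a = (\<Sum>(m, g)\<in>#a. path_weight E S (nat (N - m)) g)"

lemma weight_empty [simp]: "weight E S N {#} = 0"
  by (simp add: weight_def)

lemma weight_add [simp]: "weight E S N (a + b) = weight E S N a + weight E S N b"
  by (simp add: weight_def)

lemma weight_monomial [simp]:
  "weight E S N (monomial m g) = path_weight E S (nat (N - m)) g"
  by (simp add: weight_def monomial_def)

lemma weight_sum [simp]: "weight E S N (\<Sum>i\<in>I. f i) = (\<Sum>i\<in>I. weight E S N (f i))"
  by (induction I rule: infinite_finite_induct) auto

lemma weight_act: "weight E S N (act n a) = weight E S (N - n) a"
  by (simp add: weight_def act_def multiset.map_comp comp_def case_prod_unfold diff_diff_eq)

lemma weight_mono: "M \<le> N \<Longrightarrow> weight E S M a \<le> weight E S N a"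
  unfolding weight_def
  by (intro sum_mset_mono) (auto intro: path_weight_mono)

lemma weight_eq_0_iff: "weight E S N a = 0 \<longleftrightarrow> a = {#}"
proof (cases a)
  case (add p b)
  then show ?thesis
    using path_weight_pos[of E S "nat (N - fst p)" "snd p"]
    by (simp add: weight_def case_prod_unfold)
qed simp

text \<open>Paths from the rewritten generator are sorted by their first edge. \<open>T\<close> is
  empty, \<open>Z\<close> or \<open>W\<close> in the three cases: once it lies in \<open>S\<close>,
  the edges that the new improper vertex no longer counts are exactly those split off as separate
  summands.\<close>

lemma step1_weight:
  assumes "step1 E a b"
  shows "\<exists>T M. finite T \<and>
    (\<forall>S N. finite S \<longrightarrow> T \<subseteq> S \<longrightarrow> M \<le> N \<longrightarrow> weight E S N a = weight E S N b)"
  using assms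
proof cases
  case (A1 a' v m)
  have "weight E S N a = weight E S N b" if "m + 1 \<le> N" for S N
  proof -
    \<comment> \<open>Exposes a successor, so that the recursion unfolds once. At
      \<open>N = m\<close> the vertex would have weight 1 whatever its number of edges.\<close>
    have "nat (N - m) = Suc (nat (N - (m + 1)))" using that by simp
    then show ?thesis using A1 by (simp add: regular_vertex_def)
  qed
  then show ?thesis by (meson finite.emptyI)
next
  case (A2 a' v Z m)
  have "weight E S N a = weight E S N b" if "finite S" "Z \<subseteq> S" "m + 1 \<le> N" for S N
  proof -
    have "nat (N - m) = Suc (nat (N - (m + 1)))" using that by simp
    moreover have "sum f (out_arcs E v \<inter> S) = sum f (out_arcs E v \<inter> S - Z) + sum f Z"
      for f :: "_ \<Rightarrow> nat"
      using that A2 by (intro sum.subset_diff) auto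
    ultimately show ?thesis using A2 by (simp add: infinite_emitter_def)
  qed
  then show ?thesis using \<open>finite Z\<close> by meson
next
  case (A3 a' v W Z m)
  have "weight E S N a = weight E S N b" if "finite S" "W \<subseteq> S" "m + 1 \<le> N" for S N
  proof -
    have "nat (N - m) = Suc (nat (N - (m + 1)))" using that by simp
    moreover have "sum f (out_arcs E v \<inter> S - Z) = sum f (out_arcs E v \<inter> S - W) + sum f (W - Z)"
      for f :: "_ \<Rightarrow> nat"
    proof -
      have "out_arcs E v \<inter> S - W = (out_arcs E v \<inter> S - Z) - (W - Z)" using A3 by auto
      then show ?thesis using that A3 sum.subset_diff[of "W - Z" "out_arcs E v \<inter> S - Z" f] by auto
    qed
    ultimately show ?thesis using A3 by simp
  qed
  then show ?thesis using \<open>finite W\<close> by meson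
qed

lemma graph_cong_weight:
  assumes "graph_cong E a b"
  shows "\<exists>T M. finite T \<and>
    (\<forall>S N. finite S \<longrightarrow> T \<subseteq> S \<longrightarrow> M \<le> N \<longrightarrow> weight E S N a = weight E S N b)"
  using assms
proof induction
  case (base a b)
  then show ?case by (rule step1_weight)
next
  case (refl a)
  then show ?case by (meson finite.emptyI)
next
  case (sym a b)
  then show ?case by metis
next
  case (trans a b c)
  then obtain T M T' M' where "finite T" "finite T'"
    "\<And>S N. \<lbrakk>finite S; T \<subseteq> S; M \<le> N\<rbrakk> \<Longrightarrow> weight E S N a = weight E S N b"
    "\<And>S N. \<lbrakk>finite S; T' \<subseteq> S; M' \<le> N\<rbrakk> \<Longrightarrow> weight E S N b = weight E S N c"
    by metis
  then show ?case
    by (intro exI[of _ "T \<union> T'"] exI[of _ "max M M'"]) simp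
next
  case (add a b c d)
  then obtain T M T' M' where "finite T" "finite T'"
    "\<And>S N. \<lbrakk>finite S; T \<subseteq> S; M \<le> N\<rbrakk> \<Longrightarrow> weight E S N a = weight E S N b"
    "\<And>S N. \<lbrakk>finite S; T' \<subseteq> S; M' \<le> N\<rbrakk> \<Longrightarrow> weight E S N c = weight E S N d"
    by metis
  then show ?case
    by (intro exI[of _ "T \<union> T'"] exI[of _ "max M M'"]) simp
next
  case (act a b n)
  then obtain T M where "finite T"
    "\<And>S N. \<lbrakk>finite S; T \<subseteq> S; M \<le> N\<rbrakk> \<Longrightarrow> weight E S N a = weight E S N b"
    by metis
  then show ?case
    \<comment> \<open>Acting by \<open>n\<close> lowers the level from \<open>N\<close> to
      \<open>N - n\<close>, which must still be at least \<open>M\<close>.\<close>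
    by (intro exI[of _ T] exI[of _ "M + n"]) (simp add: weight_act)
qed

theorem proposition4p4:
  fixes E :: "('v, 'e) pre_digraph"
    and a :: "('v, 'e) formal_sum"
    and n :: nat
  assumes "wf_digraph E"
    and "a \<in> free_monoid E"
  shows "\<not> strict_prec E a (act (int n) a)"
proof
  assume "strict_prec E a (act (int n) a)"
  then obtain c where c: "graph_cong E (a + c) (act (int n) a)"
    and neq: "\<not> graph_cong E a (act (int n) a)"
    by (auto simp: strict_prec_def precsim_def)
  \<comment> \<open>The bounds themselves serve as edge set and level.\<close>
  obtain T N where "weight E T N (a + c) = weight E T N (act (int n) a)"
    using graph_cong_weight[OF c] by blast
  \<comment> \<open>Here \<open>n\<close> being nonnegative enters: the level drops to
    \<open>N - n \<le> N\<close>.\<close>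
  also have "\<dots> \<le> weight E T N a"
    by (simp add: weight_act weight_mono)
  finally have "c = {#}"
    by (simp add: weight_eq_0_iff)
  with c neq show False by simp
qed

end
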